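(* For all $i,j\in\{1,\dots,n\}$ and every integer $q\ge 0$, the element $\hat e_{ij}^q\in U(\mathfrak{so}(n,\mathbb C))$ is a linear combination of $\{\hat e_{ji}^p\}_{p=0}^q$ whose coefficients are Casimir elements (elements of the center $\mathfrak Z$), namely $$\hat e_{ij}^q=(-1)^q\hat e_{ji}^q-\frac{1-(-1)^q}{2}\hat e_{ji}^{q-1}+\sum_{p=0}^{q-1}(-1)^p\hat c_{q-1-p}\,\hat e_{ji}^p$$ (for $q=0$ the second term has coefficient $0$ and is read as $0$, and the sum is empty). Thus, for every integer $q\ge 0$, $$\hat e_{ij}^{2q}=\hat e_{ji}^{2q}+\sum_{p=0}^{2q-1}(-1)^p\hat c_{2q-1-p}\,\hat e_{ji}^p,$$ $$\hat e_{ij}^{2q+1}=-\hat e_{ji}^{2q+1}-\hat e_{ji}^{2q}+\sum_{p=0}^{2q}(-1)^p\hat c_{2q-p}\,\hat e_{ji}^p.$$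
   Context: Let $n\ge 2$ and let $\{e_i\}_{i=1}^n$ be the standard basis of $\mathbb R^n$. The Lie algebra $\mathfrak{so}(n)$ is spanned by $e_{ij}:=e_i\wedge e_j$ acting on $\mathbb R^n$ by $e_{ij}(u)=\langle e_i,u\rangle e_j-\langle e_j,u\rangle e_i$. Thus $e_{ij}=-e_{ji}$, $e_{ii}=0$, $[e_{kl},e_{ij}]=\delta_{ki}e_{lj}+\delta_{kj}e_{il}-\delta_{il}e_{kj}-\delta_{lj}e_{ik}$, and $\{e_{ij}\}_{i<j}$ is a basis. $U(\mathfrak{so}(n,\mathbb C))$ is the universal enveloping algebra of the complexification $\mathfrak{so}(n,\mathbb C)$, and $\mathfrak Z$ is its center; elements of $\mathfrak Z$ are called Casimir elements. In $U(\mathfrak{so}(n,\mathbb C))$ put $\hat e_{ij}:=e_{ij}+\frac{n-1}{2}\delta_{ij}$, $\hat e_{ij}^0:=\delta_{ij}$, and for $q\ge1$, $\hat e_{ij}^q:=\sum_{1\le i_1,\dots,i_{q-1}\le n}\hat e_{ii_1}\hat e_{i_1i_2}\cdots\hat e_{i_{q-1}j}$ (so $q$ is an upper index: $\hat e_{ij}^q$ is the $(i,j)$ entry of the $q$-th power of the matrix $(\hat e_{ij})$). Put $\hat c_q:=\sum_{i}\hat e_{ii}^q$, which lies in $\mathfrak Z$. *)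

theory Defs
  imports "HOL-Analysis.Analysis" "HOL-Library.Poly_Mapping"
begin
class scaleC =
  fixes scaleC :: "complex \<Rightarrow> 'a \<Rightarrow> 'a"  (infixr "*\<^sub>C" 75)

class complex_vector = scaleC + ab_group_add +
  assumes scaleC_add_right: "a *\<^sub>C (x + y) = a *\<^sub>C x + a *\<^sub>C y"
    and scaleC_add_left: "(a + b) *\<^sub>C x = a *\<^sub>C x + b *\<^sub>C x"
    and scaleC_scaleC: "a *\<^sub>C b *\<^sub>C x = (a * b) *\<^sub>C x"
    and scaleC_one: "1 *\<^sub>C x = x"

class complex_algebra_1 = complex_vector + ring_1 +
  assumes mult_scaleC_left: "(a *\<^sub>C x) * y = a *\<^sub>C (x * y)"
    and mult_scaleC_right: "x * (a *\<^sub>C y) = a *\<^sub>C (x * y)"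

class complex_lie_algebra = complex_vector +
  fixes lie_bracket :: "'a \<Rightarrow> 'a \<Rightarrow> 'a"
  assumes lie_bracket_add_left: "lie_bracket (x + y) z = lie_bracket x z + lie_bracket y z"
    and lie_bracket_add_right: "lie_bracket x (y + z) = lie_bracket x y + lie_bracket x z"
    and lie_bracket_scaleC_left: "lie_bracket (a *\<^sub>C x) y = a *\<^sub>C lie_bracket x y"
    and lie_bracket_scaleC_right: "lie_bracket x (a *\<^sub>C y) = a *\<^sub>C lie_bracket x y"
    and lie_bracket_self: "lie_bracket x x = 0"
    and lie_bracket_jacobi:
      "lie_bracket x (lie_bracket y z) + lie_bracket y (lie_bracket z x)
        + lie_bracket z (lie_bracket x y) = 0"

definition algebra_center :: "'a::times set" where
  "algebra_center = {z. \<forall>x. z * x = x * z}"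

text \<open>Words under concatenation, written additively because the convolution product of
  \<^typ>\<open>'a \<Rightarrow>\<^sub>0 'b\<close> is taken with respect to addition on the keys.\<close>

datatype 'a word = Word (letters: "'a list")

instantiation word :: (type) monoid_add
begin
definition zero_word :: "'a word" where "0 = Word []"
definition plus_word :: "'a word \<Rightarrow> 'a word \<Rightarrow> 'a word" where
  "u + v = Word (letters u @ letters v)"
instance
  by standard (simp_all add: zero_word_def plus_word_def)
end

lemma plus_word_eq_zero_iff: "u + v = (0 :: 'a word) \<longleftrightarrow> u = 0 \<and> v = 0"
  by (cases u; cases v) (auto simp: zero_word_def plus_word_def)

lemma Word_Cons_neq_zero: "Word (x # xs) \<noteq> 0"
  by (simp add: zero_word_def)

type_synonym 'a free_algebra = "'a word \<Rightarrow>\<^sub>0 complex"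

abbreviation free_gen :: "'a \<Rightarrow> 'a free_algebra" where
  "free_gen x \<equiv> Poly_Mapping.single (Word [x]) 1"

abbreviation free_const :: "complex \<Rightarrow> 'a free_algebra" where
  "free_const c \<equiv> Poly_Mapping.single 0 c"

inductive_set two_sided_ideal :: "'r::ring_1 set \<Rightarrow> 'r set" for S where
  ideal_gen: "x \<in> S \<Longrightarrow> x \<in> two_sided_ideal S"
| ideal_zero: "0 \<in> two_sided_ideal S"
| ideal_add: "x \<in> two_sided_ideal S \<Longrightarrow> y \<in> two_sided_ideal S \<Longrightarrow> x + y \<in> two_sided_ideal S"
| ideal_mult_left: "x \<in> two_sided_ideal S \<Longrightarrow> r * x \<in> two_sided_ideal S"
| ideal_mult_right: "x \<in> two_sided_ideal S \<Longrightarrow> x * r \<in> two_sided_ideal S"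

text \<open>The first two families of relators turn the free algebra on the underlying set of the
  Lie algebra into its tensor algebra; the third one imposes \<open>x y - y x = [x, y]\<close>.\<close>

definition uea_relators :: "'g::complex_lie_algebra free_algebra set" where
  "uea_relators =
     {free_gen (x + y) - (free_gen x + free_gen y) | x y. True} \<union>
     {free_gen (c *\<^sub>C x) - free_const c * free_gen x | c x. True} \<union>
     {free_gen x * free_gen y - free_gen y * free_gen x - free_gen (lie_bracket x y) | x y. True}"

abbreviation uea_ideal :: "'g::complex_lie_algebra free_algebra set" where
  "uea_ideal \<equiv> two_sided_ideal uea_relators"

definition uea_rel :: "'g::complex_lie_algebra free_algebra \<Rightarrow> 'g free_algebra \<Rightarrow> bool" where
  "uea_rel a b \<longleftrightarrow> a - b \<in> uea_ideal"

lemma ideal_uminus: "x \<in> two_sided_ideal S \<Longrightarrow> - x \<in> two_sided_ideal S"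
  using ideal_mult_left[of x S "- 1"] by simp

lemma ideal_diff:
  "x \<in> two_sided_ideal S \<Longrightarrow> y \<in> two_sided_ideal S \<Longrightarrow> x - y \<in> two_sided_ideal S"
  using ideal_add[OF _ ideal_uminus] by fastforce

quotient_type (overloaded) 'g uea = "'g::complex_lie_algebra free_algebra" / uea_rel
proof (rule equivpI)
  show "reflp uea_rel" by (auto intro!: reflpI simp: uea_rel_def ideal_zero)
  show "symp uea_rel"
    by (rule sympI) (metis uea_rel_def ideal_uminus minus_diff_eq)
  show "transp uea_rel"
    by (rule transpI) (auto simp: uea_rel_def dest: ideal_add)
qed

lemma lookup_mult_zero_word:
  "Poly_Mapping.lookup (a * b) 0 = Poly_Mapping.lookup a 0 * Poly_Mapping.lookup b (0 :: 'g word)"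
  for a b :: "'g free_algebra"
proof -
  have "Poly_Mapping.lookup (a * b) 0 =
      Sum_any (\<lambda>l. Poly_Mapping.lookup a l * Sum_any (\<lambda>q. Poly_Mapping.lookup b q when 0 = l + q))"
    by (rule lookup_mult)
  also have "\<dots> = Sum_any (\<lambda>l :: 'g word. Poly_Mapping.lookup a 0 * Poly_Mapping.lookup b 0 when l = 0)"
  proof (rule Sum_any.cong)
    fix l :: "'g word"
    have "Sum_any (\<lambda>q. Poly_Mapping.lookup b q when 0 = l + q) =
        Sum_any (\<lambda>q :: 'g word. (Poly_Mapping.lookup b q when l = 0) when q = 0)"
      by (rule Sum_any.cong)
        (auto simp: when_def eq_commute[of 0] plus_word_eq_zero_iff)
    then show "Poly_Mapping.lookup a l * Sum_any (\<lambda>q. Poly_Mapping.lookup b q when 0 = l + q) =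
        (Poly_Mapping.lookup a 0 * Poly_Mapping.lookup b 0 when l = 0)"
      by (simp add: when_def)
  qed
  finally show ?thesis by simp
qed

lemma lookup_uea_ideal: "a \<in> uea_ideal \<Longrightarrow> Poly_Mapping.lookup a 0 = 0"
  by (induction rule: two_sided_ideal.induct)
    (auto simp: uea_relators_def lookup_minus lookup_add lookup_single lookup_mult_zero_word
      Word_Cons_neq_zero when_def)

instantiation uea :: (complex_lie_algebra) complex_algebra_1
begin

lift_definition zero_uea :: "'a uea" is 0 .
lift_definition one_uea :: "'a uea" is 1 .
lift_definition uminus_uea :: "'a uea \<Rightarrow> 'a uea" is uminus
  by (auto simp: uea_rel_def dest: ideal_uminus)
lift_definition plus_uea :: "'a uea \<Rightarrow> 'a uea \<Rightarrow> 'a uea" is "(+)"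
  by (auto simp: uea_rel_def add_diff_add intro: ideal_add)
lift_definition minus_uea :: "'a uea \<Rightarrow> 'a uea \<Rightarrow> 'a uea" is "(-)"
proof -
  fix a b c d :: "'a free_algebra"
  assume "uea_rel a b" "uea_rel c d"
  then have "(a - b) - (c - d) \<in> uea_ideal" unfolding uea_rel_def by (rule ideal_diff)
  then show "uea_rel (a - c) (b - d)" by (simp add: uea_rel_def algebra_simps)
qed
lift_definition times_uea :: "'a uea \<Rightarrow> 'a uea \<Rightarrow> 'a uea" is "(*)"
proof -
  fix a b c d :: "'a free_algebra"
  assume "uea_rel a b" "uea_rel c d"
  then have "(a - b) * c + b * (c - d) \<in> uea_ideal"
    unfolding uea_rel_def by (intro ideal_add ideal_mult_left ideal_mult_right)
  then show "uea_rel (a * c) (b * d)" by (simp add: uea_rel_def algebra_simps)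
qed
lift_definition scaleC_uea :: "complex \<Rightarrow> 'a uea \<Rightarrow> 'a uea" is "\<lambda>c a. free_const c * a"
proof -
  fix c and a b :: "'a free_algebra"
  assume "uea_rel a b"
  then have "free_const c * (a - b) \<in> uea_ideal" unfolding uea_rel_def by (rule ideal_mult_left)
  then show "uea_rel (free_const c * a) (free_const c * b)" by (simp add: uea_rel_def algebra_simps)
qed

lemma free_const_commute: "x * free_const c = free_const c * x" for x :: "'g free_algebra"
proof (rule poly_mapping_eqI)
  fix k :: "'g word"
  have R: "Sum_any (\<lambda>q. Poly_Mapping.lookup (free_const c) q when k = l + q) = (c when l = k)" for l
  proof -
    have "Sum_any (\<lambda>q. Poly_Mapping.lookup (free_const c) q when k = l + q) =
        Sum_any (\<lambda>q :: 'g word. (c when l = k) when q = 0)"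
      by (rule Sum_any.cong) (auto simp: lookup_single when_def)
    then show ?thesis by simp
  qed
  have "Poly_Mapping.lookup (x * free_const c) k = Sum_any (\<lambda>l. Poly_Mapping.lookup x k * c when l = k)"
    unfolding lookup_mult R
    by (rule Sum_any.cong) (auto simp: when_def)
  moreover have "Poly_Mapping.lookup (free_const c * x) k =
      Sum_any (\<lambda>l :: 'g word. c * Poly_Mapping.lookup x k when l = 0)"
    unfolding lookup_mult
    by (rule Sum_any.cong) (auto simp: lookup_single when_def)
  ultimately show "Poly_Mapping.lookup (x * free_const c) k = Poly_Mapping.lookup (free_const c * x) k"
    by (simp add: mult.commute)
qed

instance
proof
  fix x y z :: "'a uea" and a b :: complex
  have R: "uea_rel s t" if "s = t" for s t :: "'a free_algebra"
    using that by (simp add: uea_rel_def ideal_zero)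
  show "x + y + z = x + (y + z)"
    by (transfer, rule R, simp add: add.assoc)
  show "x + y = y + x"
    by (transfer, rule R, simp add: add.commute)
  show "0 + x = x"
    by (transfer, rule R, simp)
  show "- x + x = 0"
    by (transfer, rule R, simp)
  show "x - y = x + - y"
    by (transfer, rule R, simp)
  show "x * y * z = x * (y * z)"
    by (transfer, rule R, simp add: mult.assoc)
  show "1 * x = x"
    by (transfer, rule R, simp)
  show "x * 1 = x"
    by (transfer, rule R, simp)
  show "(x + y) * z = x * z + y * z"
    by (transfer, rule R, simp add: distrib_right)
  show "x * (y + z) = x * y + x * z"
    by (transfer, rule R, simp add: distrib_left)
  show "a *\<^sub>C (x + y) = a *\<^sub>C x + a *\<^sub>C y"
    by (transfer, rule R, simp add: distrib_left)
  show "(a + b) *\<^sub>C x = a *\<^sub>C x + b *\<^sub>C x"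
    by (transfer, rule R, simp add: single_add distrib_right)
  show "a *\<^sub>C b *\<^sub>C x = (a * b) *\<^sub>C x"
    by (transfer, rule R, simp add: mult_single mult.assoc[symmetric])
  show "1 *\<^sub>C x = x"
    by (transfer, rule R, simp)
  show "(a *\<^sub>C x) * y = a *\<^sub>C (x * y)"
    by (transfer, rule R, simp add: mult.assoc)
  show "x * (a *\<^sub>C y) = a *\<^sub>C (x * y)"
    by (transfer, rule R) (metis free_const_commute mult.assoc)
  show "(0 :: 'a uea) \<noteq> 1"
  proof (transfer, rule notI)
    assume "uea_rel 0 (1 :: 'a free_algebra)"
    from lookup_uea_ideal[OF this[unfolded uea_rel_def]] show False by (simp add: lookup_minus)
  qed
qed

end

lift_definition uea_of :: "'g::complex_lie_algebra \<Rightarrow> 'g uea" is free_gen .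

lemma uea_of_add: "uea_of (x + y) = uea_of x + uea_of y"
  by transfer (auto simp: uea_rel_def uea_relators_def intro!: ideal_gen)

lemma uea_of_scaleC: "uea_of (c *\<^sub>C x) = c *\<^sub>C uea_of x"
  by transfer (auto simp: uea_rel_def uea_relators_def intro!: ideal_gen)

lemma uea_of_lie_bracket:
  "uea_of (lie_bracket x y) = uea_of x * uea_of y - uea_of y * uea_of x"
proof transfer
  fix x y :: 'a
  have "free_gen x * free_gen y - free_gen y * free_gen x - free_gen (lie_bracket x y) \<in> uea_ideal"
    by (rule ideal_gen) (auto simp: uea_relators_def)
  from ideal_uminus[OF this]
  show "uea_rel (free_gen (lie_bracket x y)) (free_gen x * free_gen y - free_gen y * free_gen x)"
    by (simp add: uea_rel_def)
qed

lemma matrix_mult_diff_left: "(A - B) ** C = A ** C - B ** C" for A B C :: "complex ^ 'n ^ 'n"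
  by (simp add: matrix_matrix_mult_def vec_eq_iff left_diff_distrib sum_subtractf)

lemma matrix_mult_diff_right: "C ** (A - B) = C ** A - C ** B" for A B C :: "complex ^ 'n ^ 'n"
  by (simp add: matrix_matrix_mult_def vec_eq_iff right_diff_distrib sum_subtractf)

lemma matrix_mult_add_left: "(A + B) ** C = A ** C + B ** C" for A B C :: "complex ^ 'n ^ 'n"
  by (simp add: matrix_matrix_mult_def vec_eq_iff distrib_right sum.distrib)

lemma matrix_mult_minus_minus: "(- A) ** (- B) = A ** B" for A B :: "complex ^ 'n ^ 'n"
  by (simp add: matrix_matrix_mult_def vec_eq_iff)

lemma transpose_lin:
  "transpose (A + B) = transpose A + transpose B"
  "transpose (A - B) = transpose A - transpose B"
  "transpose (- A) = - transpose A"
  "transpose (\<chi> i j. c * A $ i $ j) = (\<chi> i j. c * transpose A $ i $ j)"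
  for A B :: "complex ^ 'n ^ 'n"
  by (simp_all add: transpose_def vec_eq_iff)

text \<open>The complexification of the Lie algebra of real skew-symmetric matrices, with coordinates
  indexed by \<open>'n\<close> in place of \<open>{1, \<dots>, n}\<close>.\<close>

typedef ('n::finite) so = "{A :: complex ^ 'n ^ 'n. transpose A = - A}"
  morphisms so_matrix Abs_so
  by (rule exI[of _ 0]) (simp add: transpose_def vec_eq_iff)

setup_lifting type_definition_so

instantiation so :: (finite) complex_lie_algebra
begin

lift_definition zero_so :: "'a so" is 0
  by (simp add: transpose_def vec_eq_iff)
lift_definition uminus_so :: "'a so \<Rightarrow> 'a so" is uminus
  by (simp add: transpose_lin)
lift_definition plus_so :: "'a so \<Rightarrow> 'a so \<Rightarrow> 'a so" is "(+)"
  by (simp add: transpose_lin)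
lift_definition minus_so :: "'a so \<Rightarrow> 'a so \<Rightarrow> 'a so" is "(-)"
  by (simp add: transpose_lin)
lift_definition scaleC_so :: "complex \<Rightarrow> 'a so \<Rightarrow> 'a so" is "\<lambda>c A. \<chi> i j. c * A $ i $ j"
  by (simp add: transpose_lin) (simp add: vec_eq_iff)
lift_definition lie_bracket_so :: "'a so \<Rightarrow> 'a so \<Rightarrow> 'a so" is "\<lambda>A B. A ** B - B ** A"
proof -
  fix A B :: "complex ^ 'a ^ 'a"
  assume A: "transpose A = - A" and B: "transpose B = - B"
  have "transpose (A ** B) = B ** A" "transpose (B ** A) = A ** B"
    unfolding matrix_transpose_mul A B by (rule matrix_mult_minus_minus)+
  then show "transpose (A ** B - B ** A) = - (A ** B - B ** A)" by (simp add: transpose_lin)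
qed

instance
proof
  fix x y z :: "'a so" and a b :: complex
  show "x + y + z = x + (y + z)"
    by transfer (simp add: add.assoc)
  show "x + y = y + x"
    by transfer (simp add: add.commute)
  show "0 + x = x"
    by transfer simp
  show "- x + x = 0"
    by transfer simp
  show "x - y = x + - y"
    by transfer simp
  show "a *\<^sub>C (x + y) = a *\<^sub>C x + a *\<^sub>C y"
    by transfer (simp add: vec_eq_iff distrib_left)
  show "(a + b) *\<^sub>C x = a *\<^sub>C x + b *\<^sub>C x"
    by transfer (simp add: vec_eq_iff distrib_right)
  show "a *\<^sub>C b *\<^sub>C x = (a * b) *\<^sub>C x"
    by transfer (simp add: vec_eq_iff mult.assoc)
  show "1 *\<^sub>C x = x"
    by transfer (simp add: vec_eq_iff)
  show "lie_bracket (x + y) z = lie_bracket x z + lie_bracket y z"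
    by transfer (simp add: matrix_mult_add_left matrix_add_ldistrib)
  show "lie_bracket x (y + z) = lie_bracket x y + lie_bracket x z"
    by transfer (simp add: matrix_mult_add_left matrix_add_ldistrib)
  show "lie_bracket (a *\<^sub>C x) y = a *\<^sub>C lie_bracket x y"
    by transfer (simp add: matrix_matrix_mult_def vec_eq_iff right_diff_distrib sum_distrib_left mult_ac)
  show "lie_bracket x (a *\<^sub>C y) = a *\<^sub>C lie_bracket x y"
    by transfer (simp add: matrix_matrix_mult_def vec_eq_iff right_diff_distrib sum_distrib_left mult_ac)
  show "lie_bracket x x = 0"
    by transfer simp
  show "lie_bracket x (lie_bracket y z) + lie_bracket y (lie_bracket z x)
      + lie_bracket z (lie_bracket x y) = 0"
    by transfer (simp add: matrix_mult_diff_left matrix_mult_diff_right matrix_mul_assoc)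
qed

end

text \<open>\<open>\<langle>e\<^sub>i, u\<rangle>\<close> extends complex bilinearly from \<open>\<real>\<^sup>n\<close> to the
  coordinate \<open>u $ i\<close>, so this is the matrix of the (complexified) operator \<open>e\<^sub>i\<^sub>j\<close>.\<close>

lift_definition so_e :: "'n::finite \<Rightarrow> 'n \<Rightarrow> 'n so" is
  "\<lambda>i j. matrix (\<lambda>u :: complex ^ 'n. (u $ i) *s axis j 1 - (u $ j) *s axis i 1)"
  by (auto simp: matrix_def transpose_def vec_eq_iff axis_def)

lemma so_e_swap: "so_e i j = - so_e j i"
  by transfer (auto simp: matrix_def vec_eq_iff)

lemma so_e_self: "so_e i i = 0"
  by transfer (auto simp: matrix_def vec_eq_iff)

lemma lie_bracket_so_e:
  "lie_bracket (so_e k l) (so_e i j) =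
     (if k = i then so_e l j else 0) + (if k = j then so_e i l else 0)
     - (if i = l then so_e k j else 0) - (if l = j then so_e i k else 0)"
proof -
  define M :: "'a \<Rightarrow> 'a \<Rightarrow> complex ^ 'a ^ 'a" where
    "M a b = (\<chi> r s. if r = a then (if s = b then 1 else 0) else 0)" for a b
  have MM: "M a b ** M c d = (if b = c then M a d else 0)" for a b c d
  proof -
    have "(\<Sum>t\<in>UNIV. M a b $ r $ t * M c d $ t $ s) =
        (\<Sum>t\<in>UNIV. if t = b then (if r = a \<and> b = c \<and> s = d then 1 else 0) else 0)" for r s
      by (rule sum.cong) (auto simp: M_def)
    then show ?thesis by (simp add: matrix_matrix_mult_def vec_eq_iff) (simp add: M_def)
  qed
  have e: "so_matrix (so_e a b) = M b a - M a b" for a b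
    by (simp add: so_e.rep_eq matrix_def M_def vec_eq_iff axis_def)
  have "so_matrix (lie_bracket (so_e k l) (so_e i j)) = so_matrix
     ((if k = i then so_e l j else 0) + (if k = j then so_e i l else 0)
     - (if i = l then so_e k j else 0) - (if l = j then so_e i k else 0))"
    unfolding lie_bracket_so.rep_eq e
    by (auto simp: matrix_mult_diff_left matrix_mult_diff_right MM
        minus_so.rep_eq plus_so.rep_eq zero_so.rep_eq e)
  then show ?thesis by (simp add: so_matrix_inject)
qed

definition e_hat :: "'n::finite \<Rightarrow> 'n \<Rightarrow> 'n so uea" where
  "e_hat i j = uea_of (so_e i j) + ((of_nat CARD('n) - 1) / 2 * of_bool (i = j)) *\<^sub>C 1"

text \<open>For \<open>q \<ge> 1\<close> the sum runs over the tuples \<open>(i\<^sub>1, \<dots>, i\<^bsub>q-1\<^esub>)\<close>, and the product is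
  taken from left to right along the path \<open>i, i\<^sub>1, \<dots>, i\<^bsub>q-1\<^esub>, j\<close>.\<close>

definition e_hat_pow :: "nat \<Rightarrow> 'n::finite \<Rightarrow> 'n \<Rightarrow> 'n so uea" where
  "e_hat_pow q i j =
     (if q = 0 then of_bool (i = j)
      else \<Sum>ks | length ks = q - 1. prod_list (map2 e_hat (i # ks) (ks @ [j])))"

definition c_hat :: "nat \<Rightarrow> 'n::finite so uea" where
  "c_hat q = (\<Sum>i\<in>UNIV. e_hat_pow q i i)"

lemma e_hat_pow_0: "e_hat_pow 0 i j = of_bool (i = j)"
  by (simp add: e_hat_pow_def)

lemma e_hat_pow_1: "e_hat_pow 1 i j = e_hat i j"
  by (simp add: e_hat_pow_def)

lemma e_hat_pow_Suc: "e_hat_pow (Suc q) i j = (\<Sum>k\<in>UNIV. e_hat i k * e_hat_pow q k j)"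
proof (cases q)
  case 0
  have "e_hat i k * of_bool (k = j) = (if k = j then e_hat i k else 0)" for k
    by simp
  with 0 show ?thesis by (simp add: e_hat_pow_def)
next
  case (Suc m)
  have "{ks :: 'a list. length ks = Suc m} = (\<lambda>(k, ks). k # ks) ` (UNIV \<times> {ks. length ks = m})"
    by (auto simp: length_Suc_conv image_iff)
  moreover have "inj_on (\<lambda>(k, ks). k # ks) (UNIV \<times> {ks :: 'a list. length ks = m})"
    by (auto simp: inj_on_def)
  ultimately show ?thesis
    by (simp add: e_hat_pow_def Suc sum.reindex sum_distrib_left sum.cartesian_product
        case_prod_unfold)
qed

end

theory Submission
  imports Defs
begin

text \<open>Write \<open>E\<close> for the matrix \<open>(e_hat i j)\<close>. Its entries, and those of all its powers, transform
  under the adjoint action of \<open>so(n)\<close> like the entries of a tensor with two vector indices. This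
  covariance is inherited by matrix products, by the Leibniz rule, and it forces the trace of a
  covariant matrix to commute with every \<open>e\<^sub>k\<^sub>l\<close>, hence with the whole enveloping
  algebra, which the \<open>e\<^sub>k\<^sub>l\<close> generate. So the \<open>c_hat q\<close> are Casimir elements.

  For the transposition formula, move the left factor of \<open>E\<^sup>q\<^sup>+\<^sup>1 = E E\<^sup>q\<close> to the
  right, at the cost of a commutator that covariance evaluates, and then use that the skew symmetry
  of \<open>e\<^sub>i\<^sub>j\<close> makes \<open>E + E\<^sup>T\<close> equal to \<open>n - 1\<close>. The shift
  \<open>(n - 1) / 2\<close> in \<open>E\<close> is the one for which the multiples of \<open>(E\<^sup>q)\<^sub>i\<^sub>j\<close> produced in this
  way cancel, leaving
  \<open>(E\<^sup>q\<^sup>+\<^sup>1)\<^sub>i\<^sub>j = c_hat q \<delta>\<^sub>i\<^sub>j - (E\<^sup>q)\<^sub>j\<^sub>i - \<Sum>\<^sub>k (E\<^sup>q)\<^sub>k\<^sub>j E\<^sub>k\<^sub>i\<close>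
  (lemma \<open>e_hat_pow_Suc_transpose\<close>). If \<open>(E\<^sup>q)\<^sub>k\<^sub>j\<close> is already a left combination of the
  \<open>(E\<^sup>p)\<^sub>j\<^sub>k\<close>, the last sum becomes the same combination of the
  \<open>(E\<^sup>p\<^sup>+\<^sup>1)\<^sub>j\<^sub>i\<close>, and induction on \<open>q\<close> gives the formula.\<close>

section \<open>Complex scalars\<close>

lemma scaleC_conv_mult: "c *\<^sub>C x = (c *\<^sub>C 1) * (x :: 'a::complex_algebra_1)"
  by (simp add: mult_scaleC_left)

lemma scaleC_zero_left [simp]: "0 *\<^sub>C (x :: 'a::complex_vector) = 0"
  using scaleC_add_left[of 0 0 x] by simp

lemma scaleC_minus_left: "(- c) *\<^sub>C (x :: 'a::complex_vector) = - (c *\<^sub>C x)"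
  using scaleC_add_left[of "- c" c x] by (simp add: eq_neg_iff_add_eq_0)

lemma scaleC_diff_left: "(a - b) *\<^sub>C (x :: 'a::complex_vector) = a *\<^sub>C x - b *\<^sub>C x"
  using scaleC_add_left[of a "- b" x] by (simp add: scaleC_minus_left)

lemma scaleC_of_nat: "of_nat m *\<^sub>C (1 :: 'a::complex_algebra_1) = of_nat m"
  by (induction m) (simp_all add: scaleC_add_left scaleC_one)

section \<open>The center of the enveloping algebra\<close>

lemma uea_induct [case_names one scaleC gen add mult]:
  fixes z :: "'g::complex_lie_algebra uea"
  assumes one: "P 1"
    and scaleC: "\<And>c x. P x \<Longrightarrow> P (c *\<^sub>C x)"
    and gen: "\<And>x. P (uea_of x)"
    and add: "\<And>x y. P x \<Longrightarrow> P y \<Longrightarrow> P (x + y)"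
    and mult: "\<And>x y. P x \<Longrightarrow> P y \<Longrightarrow> P (x * y)"
  shows "P z"
proof -
  have word: "P (abs_uea (Poly_Mapping.single (Word xs) c))" for xs :: "'g list" and c
  proof (induction xs)
    case Nil
    have "abs_uea (Poly_Mapping.single (Word []) c) = c *\<^sub>C (1 :: 'g uea)"
      by (simp add: one_uea_def scaleC_uea.abs_eq flip: zero_word_def)
    then show ?case by (simp add: scaleC one)
  next
    case (Cons x xs)
    have "Poly_Mapping.single (Word (x # xs)) c = free_gen x * Poly_Mapping.single (Word xs) c"
      by (simp add: mult_single plus_word_def)
    then have "abs_uea (Poly_Mapping.single (Word (x # xs)) c) =
        uea_of x * abs_uea (Poly_Mapping.single (Word xs) c)"
      by (simp add: uea_of_def times_uea.abs_eq)
    then show ?case by (simp add: mult gen Cons)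
  qed
  have "P (abs_uea f)" for f :: "'g free_algebra"
  proof (induction f rule: update_induct)
    case const
    then show ?case using scaleC[OF one, of 0] by (simp add: zero_uea_def)
  next
    case (update f k v)
    have "Poly_Mapping.update k v f = Poly_Mapping.single k v + f"
      using update(1)
      by (auto intro!: poly_mapping_eqI
          simp: lookup_update lookup_add lookup_single when_def in_keys_iff)
    then have "abs_uea (Poly_Mapping.update k v f) =
        abs_uea (Poly_Mapping.single k v) + abs_uea f"
      by (simp add: plus_uea.abs_eq)
    then show ?case using word[of "letters k" v] update(3) by (simp add: add)
  qed
  then show ?thesis by (metis Quotient_abs_rep[OF Quotient_uea])
qed

lemma uea_of_zero: "uea_of (0 :: 'g::complex_lie_algebra) = 0"
  using uea_of_add[of "0 :: 'g" 0] by simp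

lemma uea_of_minus: "uea_of (- x) = - uea_of x"
  by (rule minus_unique[symmetric]) (simp add: uea_of_zero flip: uea_of_add)

lemma uea_of_diff: "uea_of (x - y) = uea_of x - uea_of y"
  using uea_of_add[of "x - y" y] by simp

lemma uea_of_sum: "uea_of (sum f A) = (\<Sum>a\<in>A. uea_of (f a))"
  by (induction A rule: infinite_finite_induct) (simp_all add: uea_of_zero uea_of_add)

lemma so_matrix_sum: "so_matrix (sum f A) = (\<Sum>a\<in>A. so_matrix (f a))"
  by (induction A rule: infinite_finite_induct) (simp_all add: zero_so.rep_eq plus_so.rep_eq)

text \<open>The sum runs over all ordered pairs, so each basis element occurs twice with the same
  contribution, whence the factor \<open>1 / 2\<close>.\<close>

lemma so_e_span:
  "x = (\<Sum>a\<in>UNIV. \<Sum>b\<in>UNIV. (so_matrix x $ b $ a / 2) *\<^sub>C so_e a b)"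
proof -
  have skew: "so_matrix x $ s $ r = - so_matrix x $ r $ s" for r s
  proof -
    have "transpose (so_matrix x) = - so_matrix x" using so_matrix[of x] by simp
    from arg_cong[OF this, of "\<lambda>A. A $ r $ s"] show ?thesis by (simp add: transpose_def)
  qed
  have entry: "so_matrix (so_e a b) $ r $ s =
      of_bool (a = s) * of_bool (b = r) - of_bool (b = s) * of_bool (a = r)" for a b r s :: 'a
    by (auto simp: so_e.rep_eq matrix_def axis_def)
  have "so_matrix x $ r $ s =
      (\<Sum>a\<in>UNIV. \<Sum>b\<in>UNIV. so_matrix x $ b $ a / 2 * so_matrix (so_e a b) $ r $ s)" for r s
  proof -
    have "(\<Sum>a\<in>UNIV. \<Sum>b\<in>UNIV. so_matrix x $ b $ a / 2 * so_matrix (so_e a b) $ r $ s) =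
        (\<Sum>a\<in>UNIV. \<Sum>b\<in>UNIV. (if b = r then if a = s then so_matrix x $ b $ a / 2 else 0 else 0)
          - (if b = s then if a = r then so_matrix x $ b $ a / 2 else 0 else 0))"
      unfolding entry by (intro sum.cong) auto
    then show ?thesis
      by (simp add: sum_subtractf skew[of s r])
  qed
  then have "so_matrix x =
      so_matrix (\<Sum>a\<in>UNIV. \<Sum>b\<in>UNIV. (so_matrix x $ b $ a / 2) *\<^sub>C so_e a b)"
    unfolding vec_eq_iff so_matrix_sum scaleC_so.rep_eq sum_component vec_lambda_beta by blast
  then show ?thesis by (simp only: so_matrix_inject)
qed

text \<open>The centralizer of \<open>z\<close> is a subalgebra, so it is everything once it contains the generators
  \<open>e\<^sub>k\<^sub>l\<close>.\<close>

lemma algebra_center_uea_soI: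
  fixes z :: "'n::finite so uea"
  assumes "\<And>k l. uea_of (so_e k l) * z = z * uea_of (so_e k l)"
  shows "z \<in> algebra_center"
proof -
  have "z * x = x * z" for x
  proof (induction x rule: uea_induct)
    case (gen x)
    have "z * uea_of (\<Sum>a\<in>UNIV. \<Sum>b\<in>UNIV. (so_matrix x $ b $ a / 2) *\<^sub>C so_e a b) =
        uea_of (\<Sum>a\<in>UNIV. \<Sum>b\<in>UNIV. (so_matrix x $ b $ a / 2) *\<^sub>C so_e a b) * z"
      by (simp add: uea_of_sum uea_of_scaleC sum_distrib_left sum_distrib_right mult_scaleC_left
          mult_scaleC_right assms)
    then show ?case by (simp only: so_e_span[symmetric])
  next
    case (mult x y)
    have "z * (x * y) = x * z * y"
      by (simp only: mult(1) mult.assoc[symmetric])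
    then show ?case
      by (simp only: mult(2) mult.assoc)
  qed (simp_all add: mult_scaleC_left mult_scaleC_right distrib_left distrib_right)
  then show ?thesis by (simp add: algebra_center_def)
qed

lemma algebra_center_closed:
  fixes x y :: "'a::complex_algebra_1"
  shows "0 \<in> (algebra_center :: 'a set)" "1 \<in> (algebra_center :: 'a set)"
    and "x \<in> algebra_center \<Longrightarrow> c *\<^sub>C x \<in> algebra_center"
    and "x \<in> algebra_center \<Longrightarrow> y \<in> algebra_center \<Longrightarrow> x + y \<in> algebra_center"
    and "x \<in> algebra_center \<Longrightarrow> y \<in> algebra_center \<Longrightarrow> x - y \<in> algebra_center"
  by (simp_all add: algebra_center_def mult_scaleC_left mult_scaleC_right distrib_left distrib_right
      left_diff_distrib right_diff_distrib)

section \<open>Covariant matrices\<close>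

text \<open>A matrix over the enveloping algebra is covariant if its entries have the same commutators
  with the \<open>e\<^sub>k\<^sub>l\<close> as the entries \<open>e\<^sub>i\<^sub>j\<close> themselves.\<close>

definition so_covariant :: "('n::finite \<Rightarrow> 'n \<Rightarrow> 'n so uea) \<Rightarrow> bool" where
  "so_covariant X \<longleftrightarrow> (\<forall>k l i j.
     uea_of (so_e k l) * X i j - X i j * uea_of (so_e k l) =
       (if k = i then X l j else 0) + (if k = j then X i l else 0)
       - (if i = l then X k j else 0) - (if l = j then X i k else 0))"

lemma so_covariantD:
  "so_covariant X \<Longrightarrow> uea_of (so_e k l) * X i j - X i j * uea_of (so_e k l) =
       (if k = i then X l j else 0) + (if k = j then X i l else 0)
       - (if i = l then X k j else 0) - (if l = j then X i k else 0)"
  by (simp add: so_covariant_def)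

lemma so_covariant_scalar: "so_covariant (\<lambda>i j. of_bool (i = j))"
  by (auto simp: so_covariant_def)

text \<open>Commuting with \<open>e\<^sub>k\<^sub>l\<close> is a derivation, and in the product the two terms that come from the
  contracted index cancel against each other.\<close>

lemma so_covariant_mult:
  fixes X Y :: "'n::finite \<Rightarrow> 'n \<Rightarrow> 'n so uea"
  assumes "so_covariant X" "so_covariant Y"
  shows "so_covariant (\<lambda>i j. \<Sum>m\<in>UNIV. X i m * Y m j)"
  unfolding so_covariant_def
proof (intro allI)
  fix k l i j :: 'n
  define e where "e = uea_of (so_e k l)"
  have left: "(if P then x else 0) * y = (if P then x * y else 0)"
    and right: "y * (if P then x else 0) = (if P then y * x else 0)" for P and x y :: "'n so uea"
    by simp_all
  have "e * (\<Sum>m\<in>UNIV. X i m * Y m j) - (\<Sum>m\<in>UNIV. X i m * Y m j) * e =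
      (\<Sum>m\<in>UNIV. (e * X i m - X i m * e) * Y m j + X i m * (e * Y m j - Y m j * e))"
    by (simp add: sum_distrib_left sum_distrib_right algebra_simps flip: sum_subtractf)
  also have "\<dots> = (\<Sum>m\<in>UNIV.
      ((if k = i then X l m * Y m j else 0) + (if k = m then X i l * Y m j else 0)
       - (if i = l then X k m * Y m j else 0) - (if l = m then X i k * Y m j else 0))
      + ((if k = m then X i m * Y l j else 0) + (if k = j then X i m * Y m l else 0)
       - (if m = l then X i m * Y k j else 0) - (if l = j then X i m * Y m k else 0)))"
    unfolding e_def so_covariantD[OF assms(1)] so_covariantD[OF assms(2)]
    by (simp only: distrib_left distrib_right left_diff_distrib right_diff_distrib left right)
  also have "\<dots> = (if k = i then \<Sum>m\<in>UNIV. X l m * Y m j else 0)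
      + (if k = j then \<Sum>m\<in>UNIV. X i m * Y m l else 0)
      - (if i = l then \<Sum>m\<in>UNIV. X k m * Y m j else 0)
      - (if l = j then \<Sum>m\<in>UNIV. X i m * Y m k else 0)"
    by (simp add: sum.distrib sum_subtractf)
  finally show "uea_of (so_e k l) * (\<Sum>m\<in>UNIV. X i m * Y m j)
      - (\<Sum>m\<in>UNIV. X i m * Y m j) * uea_of (so_e k l) =
      (if k = i then \<Sum>m\<in>UNIV. X l m * Y m j else 0)
      + (if k = j then \<Sum>m\<in>UNIV. X i m * Y m l else 0)
      - (if i = l then \<Sum>m\<in>UNIV. X k m * Y m j else 0)
      - (if l = j then \<Sum>m\<in>UNIV. X i m * Y m k else 0)"
    by (simp add: e_def)
qed

text \<open>In the commutator of \<open>e\<^sub>k\<^sub>l\<close> with the trace, the entries \<open>(l, k)\<close> and \<open>(k, l)\<close> each occur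
  twice, with opposite signs.\<close>

lemma so_covariant_trace:
  assumes "so_covariant X"
  shows "(\<Sum>i\<in>UNIV. X i i) \<in> algebra_center"
proof (rule algebra_center_uea_soI)
  fix k l
  have "uea_of (so_e k l) * (\<Sum>i\<in>UNIV. X i i) - (\<Sum>i\<in>UNIV. X i i) * uea_of (so_e k l) =
      (\<Sum>i\<in>UNIV. uea_of (so_e k l) * X i i - X i i * uea_of (so_e k l))"
    by (simp add: sum_distrib_left sum_distrib_right sum_subtractf)
  also have "\<dots> = 0"
    unfolding so_covariantD[OF assms] by (simp add: sum.distrib sum_subtractf)
  finally show "uea_of (so_e k l) * (\<Sum>i\<in>UNIV. X i i) = (\<Sum>i\<in>UNIV. X i i) * uea_of (so_e k l)"
    by simp
qed

section \<open>Powers of the shifted matrix\<close>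

lemma so_covariant_e_hat: "so_covariant (e_hat :: 'n::finite \<Rightarrow> _)"
  unfolding so_covariant_def
proof (intro allI)
  fix k l i j :: 'n
  have "uea_of (so_e k l) * e_hat i j - e_hat i j * uea_of (so_e k l) =
      uea_of (lie_bracket (so_e k l) (so_e i j))"
    by (simp add: e_hat_def uea_of_lie_bracket distrib_left distrib_right mult_scaleC_left
        mult_scaleC_right)
  \<comment> \<open>On the right-hand side of the covariance condition the scalar parts of \<open>e_hat\<close> cancel.\<close>
  also have "\<dots> =
       (if k = i then e_hat l j else 0) + (if k = j then e_hat i l else 0)
       - (if i = l then e_hat k j else 0) - (if l = j then e_hat i k else 0)"
    unfolding lie_bracket_so_e e_hat_def
    by (cases "k = i"; cases "k = j"; cases "i = l"; cases "l = j")
      (simp_all add: uea_of_add uea_of_diff uea_of_minus uea_of_zero)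
  finally show "uea_of (so_e k l) * e_hat i j - e_hat i j * uea_of (so_e k l) =
       (if k = i then e_hat l j else 0) + (if k = j then e_hat i l else 0)
       - (if i = l then e_hat k j else 0) - (if l = j then e_hat i k else 0)" .
qed

lemma so_covariant_e_hat_pow: "so_covariant (e_hat_pow q)"
proof (induction q)
  case 0
  show ?case by (simp add: e_hat_pow_0[abs_def] so_covariant_scalar)
next
  case (Suc q)
  show ?case
    using so_covariant_mult[OF so_covariant_e_hat Suc] by (simp add: e_hat_pow_Suc[abs_def])
qed

lemma c_hat_in_center: "c_hat q \<in> algebra_center"
  unfolding c_hat_def by (rule so_covariant_trace[OF so_covariant_e_hat_pow])

lemma e_hat_pow_Suc_right: "e_hat_pow (Suc q) i j = (\<Sum>k\<in>UNIV. e_hat_pow q i k * e_hat k j)"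
proof (induction q arbitrary: i)
  case 0
  have "of_bool (i = k) * e_hat k j = (if k = i then e_hat k j else 0)" for k
    by simp
  then show ?case using e_hat_pow_1[of i j] by (simp add: e_hat_pow_0)
next
  case (Suc q)
  have "e_hat_pow (Suc (Suc q)) i j =
      (\<Sum>m\<in>UNIV. \<Sum>k\<in>UNIV. e_hat i m * e_hat_pow q m k * e_hat k j)"
    by (simp add: e_hat_pow_Suc[of "Suc q" i] Suc sum_distrib_left mult.assoc)
  also have "\<dots> = (\<Sum>k\<in>UNIV. \<Sum>m\<in>UNIV. e_hat i m * e_hat_pow q m k * e_hat k j)"
    by (rule sum.swap)
  also have "\<dots> = (\<Sum>k\<in>UNIV. e_hat_pow (Suc q) i k * e_hat k j)"
    by (simp add: e_hat_pow_Suc[of q i] sum_distrib_right)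
  finally show ?case .
qed

lemma e_hat_swap:
  "e_hat i j = (of_nat CARD('n) - 1) * of_bool (i = j) - e_hat j (i :: 'n::finite)"
proof -
  have "((of_nat CARD('n) - 1) / 2) *\<^sub>C (1 :: 'n so uea) + ((of_nat CARD('n) - 1) / 2) *\<^sub>C 1 =
      of_nat CARD('n) - 1"
    by (simp add: scaleC_diff_left scaleC_of_nat scaleC_one flip: scaleC_add_left)
  then have "e_hat i j + e_hat j i = (of_nat CARD('n) - 1) * of_bool (i = j)"
    by (simp add: e_hat_def so_e_swap[of i j] uea_of_minus so_e_self uea_of_zero)
  then show ?thesis by (simp add: algebra_simps)
qed

section \<open>Transposition\<close>

text \<open>Moving \<open>E\<^sub>i\<^sub>k\<close> past \<open>(E\<^sup>q)\<^sub>k\<^sub>j\<close> and summing over \<open>k\<close> creates \<open>(1 - n) (E\<^sup>q)\<^sub>i\<^sub>j\<close>, which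
  is cancelled by the \<open>(n - 1) (E\<^sup>q)\<^sub>i\<^sub>j\<close> that comes from replacing \<open>E\<^sub>i\<^sub>k\<close> by \<open>- E\<^sub>k\<^sub>i\<close>.\<close>

lemma e_hat_pow_Suc_transpose:
  fixes i j :: "'n::finite"
  shows "e_hat_pow (Suc q) i j =
    c_hat q * of_bool (i = j) - e_hat_pow q j i - (\<Sum>k\<in>UNIV. e_hat_pow q k j * e_hat k i)"
proof -
  let ?X = "e_hat_pow q :: 'n \<Rightarrow> _"
  let ?n = "of_nat CARD('n) :: 'n so uea"
  have comm: "e_hat i k * ?X k j - ?X k j * e_hat i k =
      uea_of (so_e i k) * ?X k j - ?X k j * uea_of (so_e i k)" for k
    by (simp add: e_hat_def distrib_left distrib_right mult_scaleC_left mult_scaleC_right)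
  have "(\<Sum>k\<in>UNIV. e_hat i k * ?X k j) - (\<Sum>k\<in>UNIV. ?X k j * e_hat i k) =
      (\<Sum>k\<in>UNIV. (if k = i then ?X k j else 0) + (if i = j then ?X k k else 0)
        - ?X i j - (if k = j then ?X k i else 0))"
    unfolding sum_subtractf[symmetric] comm so_covariantD[OF so_covariant_e_hat_pow]
    by (rule sum.cong) auto
  also have "\<dots> = ?X i j + c_hat q * of_bool (i = j) - ?n * ?X i j - ?X j i"
    by (simp add: sum.distrib sum_subtractf c_hat_def)
  finally have move: "e_hat_pow (Suc q) i j = (\<Sum>k\<in>UNIV. ?X k j * e_hat i k)
      + (?X i j + c_hat q * of_bool (i = j) - ?n * ?X i j - ?X j i)"
    by (simp add: e_hat_pow_Suc algebra_simps)
  have "(\<Sum>k\<in>UNIV. ?X k j * e_hat i k) =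
      (\<Sum>k\<in>UNIV. (if k = i then ?X k j * (?n - 1) else 0) - ?X k j * e_hat k i)"
    by (rule sum.cong[OF refl], subst e_hat_swap) (simp add: right_diff_distrib)
  also have "\<dots> = ?n * ?X i j - ?X i j - (\<Sum>k\<in>UNIV. ?X k j * e_hat k i)"
    by (simp add: sum_subtractf right_diff_distrib mult_of_nat_commute)
  finally show ?thesis by (simp add: move)
qed

text \<open>In the induction step multiplication by \<open>E\<close> raises every exponent by one and the minus sign in
  \<open>e_hat_pow_Suc_transpose\<close> alternates the signs; \<open>c_hat q \<delta>\<^sub>i\<^sub>j\<close> supplies the new summand at
  \<open>p = 0\<close>, and \<open>- (E\<^sup>q)\<^sub>j\<^sub>i\<close> turns the coefficient \<open>(1 - (- 1)\<^sup>q) / 2\<close>, which is \<open>0\<close> or \<open>1\<close>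
  by parity, into its complement.\<close>

lemma e_hat_pow_transpose:
  "e_hat_pow q i j =
      (- 1) ^ q *\<^sub>C e_hat_pow q j i - ((1 - (- 1) ^ q) / 2) *\<^sub>C e_hat_pow (q - 1) j i
      + (\<Sum>p<q. (- 1) ^ p *\<^sub>C (c_hat (q - 1 - p) * e_hat_pow p j i))"
proof (induction q arbitrary: i)
  case 0
  show ?case by (auto simp: e_hat_pow_0 scaleC_one)
next
  case (Suc q)
  have raise: "(\<Sum>k\<in>UNIV. e_hat_pow p j k * e_hat k i) = e_hat_pow (Suc p) j i" for p
    by (simp add: e_hat_pow_Suc_right)
  \<comment> \<open>At \<open>q = 0\<close> the index \<open>q - 1 + 1\<close> is not \<open>q\<close>, but then the coefficient vanishes.\<close>
  have eps: "((1 - (- 1) ^ q) / 2) *\<^sub>C e_hat_pow (Suc (q - 1)) j i =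
      ((1 - (- 1) ^ q) / 2) *\<^sub>C e_hat_pow q j i"
    by (cases q) simp_all
  have pull: "(\<Sum>k\<in>UNIV. (c *\<^sub>C f k) * e_hat k i) = c *\<^sub>C (\<Sum>k\<in>UNIV. f k * e_hat k i)"
    for c f
    by (subst (2) scaleC_conv_mult) (simp add: sum_distrib_left mult_scaleC_left)
  have "(\<Sum>k\<in>UNIV. e_hat_pow q k j * e_hat k i) =
      (\<Sum>k\<in>UNIV. ((- 1) ^ q *\<^sub>C e_hat_pow q j k
        - ((1 - (- 1) ^ q) / 2) *\<^sub>C e_hat_pow (q - 1) j k
        + (\<Sum>p<q. (- 1) ^ p *\<^sub>C (c_hat (q - 1 - p) * e_hat_pow p j k))) * e_hat k i)"
    by (rule sum.cong[OF refl], rule arg_cong[where f = "\<lambda>x. x * _"], rule Suc)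
  also have "\<dots> =
      (- 1) ^ q *\<^sub>C e_hat_pow (Suc q) j i - ((1 - (- 1) ^ q) / 2) *\<^sub>C e_hat_pow q j i
      + (\<Sum>k\<in>UNIV. \<Sum>p<q. ((- 1) ^ p *\<^sub>C (c_hat (q - 1 - p) * e_hat_pow p j k)) * e_hat k i)"
    unfolding distrib_right left_diff_distrib sum.distrib sum_subtractf pull raise eps
      sum_distrib_right ..
  also have "(\<Sum>k\<in>UNIV. \<Sum>p<q. ((- 1) ^ p *\<^sub>C (c_hat (q - 1 - p) * e_hat_pow p j k)) * e_hat k i) =
      (\<Sum>p<q. (- 1) ^ p *\<^sub>C (c_hat (q - 1 - p) * e_hat_pow (Suc p) j i))"
    by (subst sum.swap) (simp only: pull mult.assoc sum_distrib_left[symmetric] raise)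
  finally have "e_hat_pow (Suc q) i j =
      (- 1) ^ Suc q *\<^sub>C e_hat_pow (Suc q) j i
      - (e_hat_pow q j i - ((1 - (- 1) ^ q) / 2) *\<^sub>C e_hat_pow q j i)
      + (c_hat q * e_hat_pow 0 j i
        + (\<Sum>p<q. (- 1) ^ Suc p *\<^sub>C (c_hat (q - 1 - p) * e_hat_pow (Suc p) j i)))"
    by (simp add: e_hat_pow_Suc_transpose e_hat_pow_0 scaleC_minus_left sum_negf eq_commute[of j])
  also have "e_hat_pow q j i - ((1 - (- 1) ^ q) / 2) *\<^sub>C e_hat_pow q j i =
      ((1 - (- 1) ^ Suc q) / 2) *\<^sub>C e_hat_pow q j i"
  proof -
    have "(1 - (- 1) ^ Suc q) / 2 = 1 - (1 - (- 1) ^ q) / (2 :: complex)"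
      by (simp add: field_simps)
    then show ?thesis by (simp only: scaleC_diff_left scaleC_one)
  qed
  also have "c_hat q * e_hat_pow 0 j i
        + (\<Sum>p<q. (- 1) ^ Suc p *\<^sub>C (c_hat (q - 1 - p) * e_hat_pow (Suc p) j i)) =
      (\<Sum>p<Suc q. (- 1) ^ p *\<^sub>C (c_hat (q - p) * e_hat_pow p j i))"
    by (subst sum.lessThan_Suc_shift) (simp add: scaleC_one)
  finally show ?case by simp
qed

lemma e_hat_pow_central_combination:
  "\<exists>a. (\<forall>p\<le>q. a p \<in> algebra_center) \<and> e_hat_pow q i j = (\<Sum>p\<le>q. a p * e_hat_pow p j i)"
proof (intro exI conjI)
  \<comment> \<open>For \<open>q = 0\<close> the first two conditions coincide, but the second coefficient is then zero.\<close>
  let ?a = "\<lambda>p. (if p = q then (- 1) ^ q *\<^sub>C 1 else 0)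
    - (if p = q - 1 then ((1 - (- 1) ^ q) / 2) *\<^sub>C 1 else 0)
    + (if p < q then (- 1) ^ p *\<^sub>C c_hat (q - 1 - p) else 0)"
  show "\<forall>p\<le>q. ?a p \<in> algebra_center"
    by (auto intro!: algebra_center_closed c_hat_in_center)
  have "?a p * e_hat_pow p j i =
      (if p = q then (- 1) ^ q *\<^sub>C e_hat_pow p j i else 0)
      - (if p = q - 1 then ((1 - (- 1) ^ q) / 2) *\<^sub>C e_hat_pow p j i else 0)
      + (if p < q then (- 1) ^ p *\<^sub>C (c_hat (q - 1 - p) * e_hat_pow p j i) else 0)" for p
    by (auto simp: distrib_right left_diff_distrib mult_scaleC_left)
  then have "(\<Sum>p\<le>q. ?a p * e_hat_pow p j i) =
      (- 1) ^ q *\<^sub>C e_hat_pow q j i - ((1 - (- 1) ^ q) / 2) *\<^sub>C e_hat_pow (q - 1) j i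
      + (\<Sum>p\<le>q. if p < q then (- 1) ^ p *\<^sub>C (c_hat (q - 1 - p) * e_hat_pow p j i) else 0)"
    by (simp add: sum.distrib sum_subtractf)
  also have "(\<Sum>p\<le>q. if p < q then (- 1) ^ p *\<^sub>C (c_hat (q - 1 - p) * e_hat_pow p j i) else 0) =
      (\<Sum>p<q. (- 1) ^ p *\<^sub>C (c_hat (q - 1 - p) * e_hat_pow p j i))"
    by (rule sum.mono_neutral_cong_right) auto
  finally show "e_hat_pow q i j = (\<Sum>p\<le>q. ?a p * e_hat_pow p j i)"
    by (simp add: e_hat_pow_transpose[of q i j])
qed

theorem theorem3p4:
  fixes i j :: "'n::finite" and q :: nat
  assumes "CARD('n) \<ge> 2"
  shows "(\<forall>m. (c_hat m :: 'n so uea) \<in> algebra_center) \<and>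
    (\<exists>a. (\<forall>p\<le>q. a p \<in> algebra_center) \<and>
         e_hat_pow q i j = (\<Sum>p\<le>q. a p * e_hat_pow p j i)) \<and>
    e_hat_pow q i j =
      (- 1) ^ q *\<^sub>C e_hat_pow q j i - ((1 - (- 1) ^ q) / 2) *\<^sub>C e_hat_pow (q - 1) j i
      + (\<Sum>p<q. (- 1) ^ p *\<^sub>C (c_hat (q - 1 - p) * e_hat_pow p j i)) \<and>
    e_hat_pow (2 * q) i j =
      e_hat_pow (2 * q) j i
      + (\<Sum>p<2 * q. (- 1) ^ p *\<^sub>C (c_hat (2 * q - 1 - p) * e_hat_pow p j i)) \<and>
    e_hat_pow (2 * q + 1) i j =
      - e_hat_pow (2 * q + 1) j i - e_hat_pow (2 * q) j i
      + (\<Sum>p\<le>2 * q. (- 1) ^ p *\<^sub>C (c_hat (2 * q - p) * e_hat_pow p j i))"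
proof (intro conjI allI)
  show "c_hat m \<in> algebra_center" for m
    by (rule c_hat_in_center)
  show "\<exists>a. (\<forall>p\<le>q. a p \<in> algebra_center) \<and>
      e_hat_pow q i j = (\<Sum>p\<le>q. a p * e_hat_pow p j i)"
    by (rule e_hat_pow_central_combination)
  show "e_hat_pow q i j =
      (- 1) ^ q *\<^sub>C e_hat_pow q j i - ((1 - (- 1) ^ q) / 2) *\<^sub>C e_hat_pow (q - 1) j i
      + (\<Sum>p<q. (- 1) ^ p *\<^sub>C (c_hat (q - 1 - p) * e_hat_pow p j i))"
    by (rule e_hat_pow_transpose)
  show "e_hat_pow (2 * q) i j =
      e_hat_pow (2 * q) j i
      + (\<Sum>p<2 * q. (- 1) ^ p *\<^sub>C (c_hat (2 * q - 1 - p) * e_hat_pow p j i))"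
    using e_hat_pow_transpose[of "2 * q" i j] by (simp add: scaleC_one)
  show "e_hat_pow (2 * q + 1) i j =
      - e_hat_pow (2 * q + 1) j i - e_hat_pow (2 * q) j i
      + (\<Sum>p\<le>2 * q. (- 1) ^ p *\<^sub>C (c_hat (2 * q - p) * e_hat_pow p j i))"
    using e_hat_pow_transpose[of "2 * q + 1" i j]
    by (simp add: scaleC_one scaleC_minus_left lessThan_Suc_atMost)
qed

end
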